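(* Let $k\ge 2$ be an integer. If a finite graph $G$ has a star coloring with at most $k$ colors, then $G$ has an equitable partition into $k-1$ induced star forests.
   Context: A star forest is a graph each of whose connected components is a star (a tree with at most one vertex of degree greater than 1; in particular single vertices and single edges are stars; the empty graph is a star forest). A star coloring of $G$ is a proper vertex coloring such that the union of any two color classes induces a star forest. An equitable partition of $G$ into $m$ parts is a partition of the vertex set into $m$ sets $S_1,\dots,S_m$ (some possibly empty) with $||S_i|-|S_j||\le 1$ for all $i,j$; it is a partition into induced star forests if each part induces a star forest in $G$. *)

theory Defs
  imports "Graph_Theory.Graph_Theory"
begin

text \<open>
  Finite simple graphs are modelled by the locale \<^locale>\<open>graph\<close>: finite, loop-free, symmetric
  digraphs without parallel arcs. An undirected edge $uv$ is the pair of arcs $(u,v)$, $(v,u)$,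
  so the degree of a vertex is its \<^const>\<open>out_degree\<close>.

  A pair of opposite arcs is a \<^const>\<open>pre_digraph.cycle\<close> of length 2, so the library's
  \<^const>\<open>forest\<close> and \<^const>\<open>tree\<close> do not describe undirected forests and trees in this
  representation. A cycle of the undirected graph is a directed cycle of length at least 3.
\<close>

definition undirected_tree :: "('a, 'b) pre_digraph \<Rightarrow> bool" where
  "undirected_tree G \<longleftrightarrow> connected G \<and> \<not> (\<exists>p. pre_digraph.cycle G p \<and> length p \<ge> 3)"

definition star :: "('a, 'b) pre_digraph \<Rightarrow> bool" where
  "star G \<longleftrightarrow> undirected_tree G \<and>
     (\<forall>u\<in>verts G. \<forall>v\<in>verts G. out_degree G u > 1 \<longrightarrow> out_degree G v > 1 \<longrightarrow> u = v)"

definition connected_component :: "('a, 'b) pre_digraph \<Rightarrow> ('a, 'b) pre_digraph \<Rightarrow> bool" where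
  "connected_component G H \<longleftrightarrow> pre_digraph.max_subgraph G connected H"

text \<open>
  Connected graphs are nonempty in the library, so the empty graph has no connected component
  and is a star forest.
\<close>

definition star_forest :: "('a, 'b) pre_digraph \<Rightarrow> bool" where
  "star_forest G \<longleftrightarrow> (\<forall>H. connected_component G H \<longrightarrow> star H)"

definition proper_coloring :: "('a, 'b) pre_digraph \<Rightarrow> ('a \<Rightarrow> 'c) \<Rightarrow> bool" where
  "proper_coloring G c \<longleftrightarrow> (\<forall>u v. u \<rightarrow>\<^bsub>G\<^esub> v \<longrightarrow> c u \<noteq> c v)"

definition color_class :: "('a, 'b) pre_digraph \<Rightarrow> ('a \<Rightarrow> 'c) \<Rightarrow> 'c \<Rightarrow> 'a set" where
  "color_class G c i = {v \<in> verts G. c v = i}"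

definition star_coloring :: "('a, 'b) pre_digraph \<Rightarrow> ('a \<Rightarrow> 'c) \<Rightarrow> bool" where
  "star_coloring G c \<longleftrightarrow> proper_coloring G c \<and>
     (\<forall>i\<in>c ` verts G. \<forall>j\<in>c ` verts G. i \<noteq> j \<longrightarrow>
        star_forest (G \<restriction> (color_class G c i \<union> color_class G c j)))"

definition equitable_partition :: "('a, 'b) pre_digraph \<Rightarrow> nat \<Rightarrow> (nat \<Rightarrow> 'a set) \<Rightarrow> bool" where
  "equitable_partition G m S \<longleftrightarrow>
     (\<Union>i<m. S i) = verts G \<and> disjoint_family_on S {..<m} \<and>
     (\<forall>i<m. \<forall>j<m. \<bar>int (card (S i)) - int (card (S j))\<bar> \<le> 1)"

end

theory Submission
  imports Defs
begin

text \<open>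
  Merge a smallest color class with a suitable part of a largest one so as to obtain a part of the
  prescribed size. It induces a star forest since subgraphs of star forests are star forests, and
  what remains has one color fewer. Averaging shows that the two classes together are large enough.
\<close>

section \<open>Subgraphs of star forests\<close>

text \<open>By finiteness, among the connected subgraphs of \<open>G\<close> that contain
  \<open>H\<close> there is a largest one, and it is a component.\<close>

lemma connected_subgraph_in_component:
  assumes "fin_digraph G" "subgraph H G" "connected H"
  shows "\<exists>K. connected_component G K \<and> subgraph H K"
proof -
  interpret fin_digraph G by fact
  define P where "P K \<longleftrightarrow> subgraph H K \<and> subgraph K G \<and> connected K" for K
  \<comment> \<open>Subgraphs need not be induced, so arcs are counted along with vertices: if
    \<open>f\<close> does not grow from \<open>K\<close> to a supergraph \<open>K'\<close>, both
    counts agree, hence both sets, and \<open>K' = K\<close>.\<close>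
  define f where "f K = card (verts K) + card (arcs K)" for K :: "('a, 'b) pre_digraph"
  have "wf_digraph H" using assms(2) by auto
  then have "P H" unfolding P_def using assms by (auto intro: wf_digraph.subgraph_refl)
  moreover have "f K < Suc (card (verts G) + card (arcs G))" if "P K" for K
    using that unfolding P_def f_def subgraph_def
    by (simp add: add_mono card_mono less_Suc_eq_le)
  ultimately obtain K where K: "P K" and max: "\<And>K'. P K' \<Longrightarrow> f K' \<le> f K"
    using Lattices_Big.ex_has_greatest_nat[of P H f] by blast
  have "K' = K" if sub: "subgraph K K'" "subgraph K' G" and con: "connected K'" for K'
  proof -
    have "P K'"
      using K sub con unfolding P_def by (blast intro: subgraph_trans)
    then have le: "f K' \<le> f K" by (rule max)
    have fin: "finite (verts K')" "finite (arcs K')"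
      using sub(2) by (auto simp: subgraph_def intro: finite_subset)
    have incl: "verts K \<subseteq> verts K'" "arcs K \<subseteq> arcs K'" using sub(1) by auto
    have "card (verts K) \<le> card (verts K')" "card (arcs K) \<le> card (arcs K')"
      using fin incl by (auto intro: card_mono)
    with le have "card (verts K) = card (verts K')" "card (arcs K) = card (arcs K')"
      by (auto simp: f_def)
    then have "verts K = verts K'" "arcs K = arcs K'"
      using fin incl by (simp_all add: card_subset_eq)
    then show ?thesis
      using sub(1) by (auto simp: subgraph_def compatible_def intro: pre_digraph.equality)
  qed
  then have "connected_component G K"
    using K unfolding connected_component_def P_def by (intro max_subgraphI) auto
  then show ?thesis using K P_def by blast
qed

lemma out_degree_subgraph_le:
  assumes "fin_digraph G" "subgraph H G"
  shows "out_degree H v \<le> out_degree G v"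
  unfolding out_degree_def
proof (rule card_mono)
  show "finite (out_arcs G v)"
    using assms(1) by (auto simp: out_arcs_def fin_digraph.finite_arcs)
  show "out_arcs H v \<subseteq> out_arcs G v"
    using assms(2) by (auto simp: out_arcs_def subgraph_def compatible_def)
qed

text \<open>Passing to a subgraph creates no cycle and raises no degree, so only connectedness can
  be lost; it is therefore assumed.\<close>

lemma star_subgraph:
  assumes "fin_digraph G" "star G" "subgraph H G" "connected H"
  shows "star H"
  unfolding star_def undirected_tree_def
proof (intro conjI ballI impI notI)
  interpret fin_digraph G by fact
  show "connected H" by fact
  show False if "\<exists>p. pre_digraph.cycle H p \<and> 3 \<le> length p"
    using that assms(2,3) subgraph_cycle by (auto simp: star_def undirected_tree_def)
  show "u = v" if "u \<in> verts H" "v \<in> verts H" "1 < out_degree H u" "1 < out_degree H v" for u v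
  proof -
    have "u \<in> verts G" "v \<in> verts G" using that assms(3) by auto
    moreover have "1 < out_degree G u" "1 < out_degree G v"
      using that out_degree_subgraph_le[OF assms(1,3)] by (meson less_le_trans)+
    ultimately show ?thesis using assms(2) by (auto simp: star_def)
  qed
qed

text \<open>A component of \<open>H\<close> is connected in \<open>G\<close>, hence lies inside a
  component of \<open>G\<close>, which is a star, and \<open>star_subgraph\<close> applies.\<close>

lemma star_forest_subgraph:
  assumes "fin_digraph G" "star_forest G" "subgraph H G"
  shows "star_forest H"
  unfolding star_forest_def
proof (intro allI impI)
  fix C assume C: "connected_component H C"
  then have sub: "subgraph C H" and con: "connected C"
    by (auto simp: connected_component_def pre_digraph.max_subgraph_def)
  have "subgraph C G" using sub assms(3) by (rule subgraph_trans)
  then obtain K where K: "connected_component G K" "subgraph C K"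
    using connected_subgraph_in_component[OF assms(1) _ con] by blast
  have subK: "subgraph K G"
    using K(1) by (simp add: connected_component_def pre_digraph.max_subgraph_def)
  have "fin_digraph K" using assms(1) subK by (rule fin_digraph.fin_digraph_subgraph)
  moreover have "star K" using K(1) assms(2) by (simp add: star_forest_def)
  ultimately show "star C" using K(2) con by (rule star_subgraph)
qed

text \<open>Serves for a single color class, about which \<open>star_coloring\<close> says nothing
  directly when there is no second nonempty class to pair it with.\<close>

lemma star_forest_arcless:
  assumes "arcs G = {}"
  shows "star_forest G"
  unfolding star_forest_def
proof (intro allI impI)
  fix C assume "connected_component G C"
  then have con: "connected C" and "arcs C = {}"
    using assms by (auto simp: connected_component_def pre_digraph.max_subgraph_def subgraph_def)
  then have "\<not> pre_digraph.cycle C p" "out_degree C v = 0" for p v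
    by (auto simp: pre_digraph.cycle_def pre_digraph.awalk_def out_degree_def out_arcs_def)
  then show "star C" using con by (auto simp: star_def undirected_tree_def)
qed

lemma (in wf_digraph) star_forest_induce_mono:
  assumes "finite (arcs G)" "finite Y" "star_forest (G \<restriction> Y)" "X \<subseteq> Y"
  shows "star_forest (G \<restriction> X)"
proof (rule star_forest_subgraph)
  show "fin_digraph (G \<restriction> Y)"
    using assms(1,2) by (intro wf_digraph.fin_digraphI wellformed_induce_subgraph) auto
  show "subgraph (G \<restriction> X) (G \<restriction> Y)"
    using assms(4) wellformed_induce_subgraph
    by (auto simp: subgraph_def compatible_def)
qed fact

section \<open>Balancing\<close>

text \<open>Abstract form of the balancing, with \<open>P\<close> standing for inducing a star
  forest. Equitability is expressed by a number \<open>q\<close> that stays fixed during the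
  induction: all parts have size \<open>q\<close> or \<open>q + 1\<close>. This is possible only if
  the total lies between \<open>q * m\<close> and \<open>(q + 1) * m\<close>, and that condition is
  the invariant. The sets \<open>V i\<close> may be empty, as they can become during the
  induction.\<close>

lemma equitable_merging:
  fixes V :: "'i \<Rightarrow> 'a set"
  assumes "m \<ge> 1" "finite I" "card I = Suc m" "\<And>i. i \<in> I \<Longrightarrow> finite (V i)"
    and "disjoint_family_on V I"
    and "\<And>i j. i \<in> I \<Longrightarrow> j \<in> I \<Longrightarrow> i \<noteq> j \<Longrightarrow> P (V i \<union> V j)"
    and mono: "\<And>X Y. P Y \<Longrightarrow> X \<subseteq> Y \<Longrightarrow> P X"
    and "q * m \<le> card (\<Union>i\<in>I. V i)" "card (\<Union>i\<in>I. V i) \<le> Suc q * m"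
  shows "\<exists>S. (\<Union>i<m. S i) = (\<Union>i\<in>I. V i) \<and> disjoint_family_on S {..<m} \<and>
    (\<forall>i<m. P (S i) \<and> q \<le> card (S i) \<and> card (S i) \<le> Suc q)"
  using assms(1-6,8,9)
proof (induction m arbitrary: I V rule: nat_induct_at_least)
  \<comment> \<open>With two sets and one part, the part is their union, and the bounds on the total
    are the bounds on its size.\<close>
  case base
  then obtain i j where "I = {i, j}" "i \<noteq> j"
    by (metis One_nat_def Suc_1 card_2_iff)
  then show ?case
    using base by (intro exI[of _ "\<lambda>_. V i \<union> V j"]) (auto simp: disjoint_family_on_def)
next
  case (Suc m)
  define n where "n = card (\<Union>i\<in>I. V i)"
  have n: "n = (\<Sum>i\<in>I. card (V i))"
    unfolding n_def using Suc.prems(1,3,4)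
    by (intro card_UN_disjoint) (auto simp: disjoint_family_on_def)
  have nb: "q * Suc m \<le> n" "n \<le> Suc q * Suc m" using Suc.prems unfolding n_def by auto
  \<comment> \<open>Size of the part to split off. It is \<open>q\<close> unless the total attains
    its upper bound, in which case every part must have size \<open>q + 1\<close>. With this choice
    the other \<open>m\<close> parts again have a total within the bounds for \<open>q\<close>, as
    \<open>rest\<close> records.\<close>
  define t where "t = (if n = Suc q * Suc m then Suc q else q)"
  have t: "q \<le> t" "t \<le> Suc q" by (auto simp: t_def)
  have tn: "t * Suc m \<le> n" using nb by (auto simp: t_def)
  have rest: "q * m + t \<le> n" "n \<le> Suc q * m + t" using nb by (auto simp: t_def)
  have "I \<noteq> {}" using Suc.prems(2) by auto
  then obtain a where a: "a \<in> I" "\<And>i. i \<in> I \<Longrightarrow> card (V a) \<le> card (V i)"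
    using obtains_MIN[of I "\<lambda>i. card (V i)"] Suc.prems(1)
    by (metis Min_le finite_imageI imageI)
  have cI: "card (I - {a}) = Suc m" using a(1) Suc.prems(1,2) by simp
  then have "I - {a} \<noteq> {}" by fastforce
  then obtain b where b: "b \<in> I - {a}" and "Max ((\<lambda>i. card (V i)) ` (I - {a})) = card (V b)"
    using obtains_MAX[of "I - {a}" "\<lambda>i. card (V i)"] Suc.prems(1) by blast
  then have bmax: "card (V i) \<le> card (V b)" if "i \<in> I - {a}" for i
    using that Suc.prems(1) Max_ge[of "(\<lambda>i. card (V i)) ` (I - {a})" "card (V i)"] by auto
  \<comment> \<open>There are \<open>m + 2\<close> classes but only \<open>m + 1\<close> parts, so a
    smallest class has at most the average size, which is below \<open>q + 1\<close>; thus it fits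
    into the new part.\<close>
  have "card I * card (V a) \<le> n"
    unfolding n using sum_bounded_below[of I "card (V a)" "\<lambda>i. card (V i)"] a(2) by simp
  then have "Suc (Suc m) * card (V a) \<le> Suc q * Suc m" using nb(2) Suc.prems(2) by simp
  have va: "card (V a) \<le> t"
  proof (rule ccontr)
    assume "\<not> ?thesis"
    then have "Suc q \<le> card (V a)" using t by simp
    then have "Suc (Suc m) * Suc q \<le> Suc (Suc m) * card (V a)" by (rule mult_le_mono2)
    also have "\<dots> \<le> Suc q * Suc m" by fact
    finally show False by simp
  qed
  \<comment> \<open>Pairing one copy of \<open>V a\<close> with each of the \<open>m + 1\<close>
    other classes, all of size at most that of \<open>V b\<close>, shows that \<open>V a\<close> and
    \<open>V b\<close> together hold at least the average \<open>n / (m + 1)\<close>, hence at least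
    \<open>t\<close> elements.\<close>
  have "n = card (V a) + (\<Sum>i\<in>I - {a}. card (V i))"
    unfolding n using a(1) Suc.prems(1) by (simp add: sum.remove)
  also have "\<dots> \<le> card (V a) + Suc m * card (V b)"
    using sum_bounded_above[of "I - {a}" "\<lambda>i. card (V i)" "card (V b)"] bmax cI by simp
  also have "\<dots> \<le> Suc m * (card (V a) + card (V b))" by (simp add: algebra_simps)
  finally have "t * Suc m \<le> Suc m * (card (V a) + card (V b))" using tn by linarith
  then have tab: "t \<le> card (V a) + card (V b)"
    by (metis Suc_mult_le_cancel1 mult.commute)
  have ab: "a \<noteq> b" "b \<in> I" using b by auto
  have dab: "V a \<inter> V b = {}"
    using Suc.prems(4) a(1) ab by (auto simp: disjoint_family_on_def)
  have "t - card (V a) \<le> card (V b)" using tab by simp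
  then obtain B where B: "B \<subseteq> V b" "card B = t - card (V a)"
    by (rule obtain_subset_with_card_n)
  define T where "T = V a \<union> B"
  have finT: "finite T" using Suc.prems(3) a(1) ab B(1) by (auto simp: T_def intro: finite_subset)
  have "card T = card (V a) + card B"
    unfolding T_def using Suc.prems(3) a(1) ab B(1) dab
    by (intro card_Un_disjoint) (auto intro: finite_subset)
  then have cT: "card T = t" using B(2) va by simp
  have PT: "P T"
    using mono[OF Suc.prems(5)[OF a(1) ab(2) ab(1)]] B(1) unfolding T_def by blast
  define W where "W i = V i - T" for i
  have TU: "T \<subseteq> (\<Union>i\<in>I. V i)" using a(1) ab B(1) by (auto simp: T_def)
  have WU: "(\<Union>i\<in>I - {a}. W i) = (\<Union>i\<in>I. V i) - T" by (auto simp: W_def T_def)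
  have cW: "card (\<Union>i\<in>I - {a}. W i) = n - t"
    unfolding WU n_def using TU finT cT by (simp add: card_Diff_subset)
  have "\<exists>S. (\<Union>i<m. S i) = (\<Union>i\<in>I - {a}. W i) \<and> disjoint_family_on S {..<m} \<and>
    (\<forall>i<m. P (S i) \<and> q \<le> card (S i) \<and> card (S i) \<le> Suc q)"
  proof (rule Suc.IH)
    show "disjoint_family_on W (I - {a})"
      using Suc.prems(4) unfolding disjoint_family_on_def W_def by blast
    show "P (W i \<union> W j)" if "i \<in> I - {a}" "j \<in> I - {a}" "i \<noteq> j" for i j
      using that by (intro mono[OF Suc.prems(5)[of i j]]) (auto simp: W_def)
    show "q * m \<le> card (\<Union>i\<in>I - {a}. W i)" "card (\<Union>i\<in>I - {a}. W i) \<le> Suc q * m"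
      using rest unfolding cW by auto
  qed (use Suc.prems(1,3) cI in \<open>auto simp: W_def\<close>)
  then obtain S where S: "(\<Union>i<m. S i) = (\<Union>i\<in>I. V i) - T" "disjoint_family_on S {..<m}"
    "\<And>i. i < m \<Longrightarrow> P (S i) \<and> q \<le> card (S i) \<and> card (S i) \<le> Suc q"
    unfolding WU by blast
  define S' where "S' = S(m := T)"
  have "(\<Union>i<Suc m. S' i) = T \<union> (\<Union>i<m. S i)" by (auto simp: S'_def lessThan_Suc)
  then have "(\<Union>i<Suc m. S' i) = (\<Union>i\<in>I. V i)" using S(1) TU by auto
  moreover have "disjoint_family_on S' {..<Suc m}"
  proof -
    have "T \<inter> (\<Union>i<m. S' i) = {}" using S(1) by (auto simp: S'_def)
    moreover have "disjoint_family_on S' {..<m}"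
      using S(2) by (simp add: S'_def disjoint_family_on_def)
    ultimately show ?thesis
      by (simp add: lessThan_Suc disjoint_family_on_insert) (simp add: S'_def)
  qed
  moreover have "P (S' i) \<and> q \<le> card (S' i) \<and> card (S' i) \<le> Suc q" if "i < Suc m" for i
    using that S(3) PT cT t by (auto simp: S'_def less_Suc_eq)
  ultimately show ?case by blast
qed

theorem theorem6:
  fixes G :: "('a, 'b) pre_digraph" and c :: "'a \<Rightarrow> 'c" and k :: nat
  assumes "k \<ge> 2"
    and "graph G"
    and "star_coloring G c"
    and "card (c ` verts G) \<le> k"
  shows "\<exists>S. equitable_partition G (k - 1) S \<and> (\<forall>i<k - 1. star_forest (G \<restriction> S i))"
proof -
  interpret graph G by fact
  obtain h where h: "inj_on h (c ` verts G)" "h ` c ` verts G \<subseteq> {..<k}"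
    using card_le_inj[of "c ` verts G" "{..<k}"] assms(4) by auto
  define V where "V i = {v \<in> verts G. h (c v) = i}" for i
  have finV: "finite (V i)" for i by (simp add: V_def)
  have cls: "V (h (c v)) = color_class G c (c v)" if "v \<in> verts G" for v
    using that h(1) by (auto simp: V_def color_class_def inj_on_def)
  have arcless: "star_forest (G \<restriction> V i)" for i
  proof (rule star_forest_arcless)
    have "tail G e \<notin> V i \<or> head G e \<notin> V i" if "e \<in> arcs G" for e
    proof -
      have "c (tail G e) \<noteq> c (head G e)"
        using assms(3) in_arcs_imp_in_arcs_ends[OF that]
        unfolding star_coloring_def proper_coloring_def by blast
      then have "h (c (tail G e)) \<noteq> h (c (head G e))"
        using h(1) that by (simp add: inj_on_eq_iff)
      then show ?thesis by (auto simp: V_def)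
    qed
    then show "arcs (G \<restriction> V i) = {}" by auto
  qed
  \<comment> \<open>The star coloring covers only pairs of colors that occur. If one class is empty,
    the union is a single class, which has no arcs.\<close>
  have pair: "star_forest (G \<restriction> (V i \<union> V j))" if "i \<noteq> j" for i j
  proof (cases "V i = {} \<or> V j = {}")
    case True
    then show ?thesis using arcless[of i] arcless[of j] by auto
  next
    case False
    then obtain u v where uv: "u \<in> verts G" "i = h (c u)" "v \<in> verts G" "j = h (c v)"
      by (auto simp: V_def)
    then have "c u \<noteq> c v" using that by auto
    then have "star_forest (G \<restriction> (color_class G c (c u) \<union> color_class G c (c v)))"
      using assms(3) uv by (simp add: star_coloring_def)
    then show ?thesis using uv cls by simp
  qed
  have UV: "(\<Union>i<k. V i) = verts G" using h(2) by (auto simp: V_def)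
  let ?n = "card (verts G)" and ?m = "k - 1"
  let ?q = "?n div ?m"
  have m: "?m \<ge> 1" using assms(1) by simp
  \<comment> \<open>The induced subgraph on an arbitrary set may have infinitely many vertices,
    so being a star forest is passed to subsets only together with finiteness.\<close>
  have "\<exists>S. (\<Union>i<?m. S i) = (\<Union>i<k. V i) \<and> disjoint_family_on S {..<?m} \<and>
    (\<forall>i<?m. (finite (S i) \<and> star_forest (G \<restriction> S i)) \<and> ?q \<le> card (S i) \<and> card (S i) \<le> Suc ?q)"
  proof (rule equitable_merging[OF m])
    show "disjoint_family_on V {..<k}" by (auto simp: V_def disjoint_family_on_def)
    show "finite X \<and> star_forest (G \<restriction> X)"
      if "finite Y \<and> star_forest (G \<restriction> Y)" "X \<subseteq> Y" for X Y
      using that star_forest_induce_mono[OF finite_arcs, of Y X] by (auto intro: finite_subset)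
    show "?q * ?m \<le> card (\<Union>i<k. V i)" by (simp add: UV)
    \<comment> \<open>The remainder of the division by \<open>k - 1\<close> is smaller than
      \<open>k - 1\<close>.\<close>
    show "card (\<Union>i<k. V i) \<le> Suc ?q * ?m"
      unfolding UV mult_Suc using m by (intro less_imp_le dividend_less_div_times) simp
  qed (use assms(1) finV pair in auto)
  then obtain S where S: "(\<Union>i<?m. S i) = verts G" "disjoint_family_on S {..<?m}"
    "\<forall>i<?m. star_forest (G \<restriction> S i)" "\<forall>i<?m. ?q \<le> card (S i) \<and> card (S i) \<le> Suc ?q"
    unfolding UV by auto
  have "\<bar>int (card (S i)) - int (card (S j))\<bar> \<le> 1" if "i < ?m" "j < ?m" for i j
    using S(4)[rule_format, OF that(1)] S(4)[rule_format, OF that(2)] by linarith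
  then show ?thesis using S(1-3) by (auto simp: equitable_partition_def)
qed

end
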